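(* Let $\alpha,\lambda,\epsilon,\gamma,\nu\in\mathbb{R}$ with $\alpha\neq 0$ and $\lambda\neq\epsilon$, and consider the Hamiltonian $H=\gamma h_1+\nu h_2$ on $\mathcal{L}_+(5)\cong\mathbb{R}^{10}$ equipped with the Poisson bracket $\{\cdot,\cdot\}_{\lambda,\alpha}$. Then the functions $$h_1,\quad h_2,\quad \vec{\mu}^2,\quad \mu_3,\quad a,\quad h_1-c_1,\quad h_2-c_2$$ are integrals of motion of the Hamiltonian system defined by $H$ (i.e. each of them has zero $\{\cdot,\cdot\}_{\lambda,\alpha}$-bracket with $H$), and they are pairwise in involution with respect to $\{\cdot,\cdot\}_{\lambda,\alpha}$.
   Context: $\mathcal{L}_+(5)$ is the 10-dimensional real vector space of strictly upper triangular $5\times5$ real matrices, with global linear coordinates $(a,\vec{x},\vec{y},\vec{\mu})$, $a\in\mathbb{R}$, $\vec{x},\vec{y},\vec{\mu}\in\mathbb{R}^3$. Dot and cross denote the standard scalar and vector products in $\mathbb{R}^3$, and $\vec v^{\,2}=\vec v\cdot\vec v$. For smooth functions $f,g$ of $(a,\vec x,\vec y,\vec\mu)$ the (Lie--)Poisson bracket is $$\{f,g\}_{\lambda,\alpha}=\lambda a\Big(\tfrac{\partial f}{\partial\vec{x}}\cdot\tfrac{\partial g}{\partial\vec{y}}-\tfrac{\partial f}{\partial\vec{y}}\cdot\tfrac{\partial g}{\partial\vec{x}}\Big)+\vec{\mu}\cdot\Big(\alpha\lambda\,\tfrac{\partial f}{\partial\vec{x}}\times\tfrac{\partial g}{\partial\vec{x}}+\lambda\,\tfrac{\partial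 f}{\partial\vec{y}}\times\tfrac{\partial g}{\partial\vec{y}}+\tfrac{\partial f}{\partial\vec{\mu}}\times\tfrac{\partial g}{\partial\vec{\mu}}\Big)$$ $$+\tfrac{\partial g}{\partial a}\,\vec{x}\cdot\tfrac{\partial f}{\partial\vec{y}}-\tfrac{\partial f}{\partial a}\,\vec{x}\cdot\tfrac{\partial g}{\partial\vec{y}}-\alpha\tfrac{\partial g}{\partial a}\,\vec{y}\cdot\tfrac{\partial f}{\partial\vec{x}}+\alpha\tfrac{\partial f}{\partial a}\,\vec{y}\cdot\tfrac{\partial g}{\partial\vec{x}}$$ $$+\vec{x}\cdot\Big(\tfrac{\partial f}{\partial\vec{x}}\times\tfrac{\partial g}{\partial\vec{\mu}}+\tfrac{\partial f}{\partial\vec{\mu}}\times\tfrac{\partial g}{\partial\vec{x}}\Big)+\vec{y}\cdot\Big(\tfrac{\partial f}{\partial\vec{y}}\times\tfrac{\partial g}{\partial\vec{\mu}}+\tfrac{\partial f}{\partial\vec{\mu}}\times\tfrac{\partial g}{\partial\vec{y}}\Big).$$ The functions involved are $$c_1=\vec{x}^{\,2}+\alpha\vec{y}^{\,2}+\alpha\lambda\vec{\mu}^2+\lambda a^2,\qquad c_2=\alpha\lambda(\vec{\mu}\cdot\vec{y})^2+\lambda(\vec{\mu}\cdot\vec{x})^2+(\lambda a\vec{\mu}-\vec{x}\times\vec{y})^2,$$ $$h_1=\vec{x}^{\,2}+\alpha\vec{y}^{\,2}+\alpha\epsilon\vec{\mu}^2+\epsilon a^2,\qquad h_2=\alpha\epsilon(\vec{\mu}\cdot\vec{y})^2+\epsilon(\vec{\mu}\cdot\vec{x})^2+(\epsilon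 a\vec{\mu}-\vec{x}\times\vec{y})^2.$$ Two functions are in involution if their bracket vanishes identically. *)

theory Defs
  imports "HOL-Analysis.Analysis"
begin

unbundle cross3_syntax

text \<open>
  The space of strictly upper triangular real 5 by 5 matrices is represented by its global
  linear coordinates \<open>(a, x, y, \<mu>)\<close>.  Throughout, \<open>lam\<close> is the parameter \<open>\<lambda>\<close> of the bracket.
\<close>

type_synonym L5 = "real \<times> (real^3) \<times> (real^3) \<times> (real^3)"

definition gradient :: "(real^3 \<Rightarrow> real) \<Rightarrow> real^3 \<Rightarrow> real^3" where
  "gradient g v = (\<chi> i. frechet_derivative g (at v) (axis i 1))"

definition d_a :: "(L5 \<Rightarrow> real) \<Rightarrow> L5 \<Rightarrow> real" where
  "d_a f = (\<lambda>(a, x, y, \<mu>). deriv (\<lambda>a'. f (a', x, y, \<mu>)) a)"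

definition d_x :: "(L5 \<Rightarrow> real) \<Rightarrow> L5 \<Rightarrow> real^3" where
  "d_x f = (\<lambda>(a, x, y, \<mu>). gradient (\<lambda>x'. f (a, x', y, \<mu>)) x)"

definition d_y :: "(L5 \<Rightarrow> real) \<Rightarrow> L5 \<Rightarrow> real^3" where
  "d_y f = (\<lambda>(a, x, y, \<mu>). gradient (\<lambda>y'. f (a, x, y', \<mu>)) y)"

definition d_mu :: "(L5 \<Rightarrow> real) \<Rightarrow> L5 \<Rightarrow> real^3" where
  "d_mu f = (\<lambda>(a, x, y, \<mu>). gradient (\<lambda>\<mu>'. f (a, x, y, \<mu>')) \<mu>)"

text \<open>
  The bracket is meant for smooth \<open>f\<close> and \<open>g\<close>; at points where a partial derivative does not
  exist its value carries no meaning.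
\<close>

definition bracket :: "real \<Rightarrow> real \<Rightarrow> (L5 \<Rightarrow> real) \<Rightarrow> (L5 \<Rightarrow> real) \<Rightarrow> L5 \<Rightarrow> real" where
  "bracket lam \<alpha> f g = (\<lambda>p. case p of (a, x, y, \<mu>) \<Rightarrow>
      lam * a * (d_x f p \<bullet> d_y g p - d_y f p \<bullet> d_x g p)
    + \<mu> \<bullet> ((\<alpha> * lam) *\<^sub>R (d_x f p \<times> d_x g p) + lam *\<^sub>R (d_y f p \<times> d_y g p)
          + (d_mu f p \<times> d_mu g p))
    + d_a g p * (x \<bullet> d_y f p) - d_a f p * (x \<bullet> d_y g p)
    - \<alpha> * d_a g p * (y \<bullet> d_x f p) + \<alpha> * d_a f p * (y \<bullet> d_x g p)
    + x \<bullet> ((d_x f p \<times> d_mu g p) + (d_mu f p \<times> d_x g p))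
    + y \<bullet> ((d_y f p \<times> d_mu g p) + (d_mu f p \<times> d_y g p)))"

definition in_involution :: "real \<Rightarrow> real \<Rightarrow> (L5 \<Rightarrow> real) \<Rightarrow> (L5 \<Rightarrow> real) \<Rightarrow> bool" where
  "in_involution lam \<alpha> f g \<longleftrightarrow> (\<forall>p. bracket lam \<alpha> f g p = 0)"

definition integral_of_motion :: "real \<Rightarrow> real \<Rightarrow> (L5 \<Rightarrow> real) \<Rightarrow> (L5 \<Rightarrow> real) \<Rightarrow> bool" where
  "integral_of_motion lam \<alpha> H f \<longleftrightarrow> (\<forall>p. bracket lam \<alpha> f H p = 0)"

definition c1 :: "real \<Rightarrow> real \<Rightarrow> L5 \<Rightarrow> real" where
  "c1 lam \<alpha> = (\<lambda>(a, x, y, \<mu>). x \<bullet> x + \<alpha> * (y \<bullet> y) + \<alpha> * lam * (\<mu> \<bullet> \<mu>) + lam * a\<^sup>2)"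

definition c2 :: "real \<Rightarrow> real \<Rightarrow> L5 \<Rightarrow> real" where
  "c2 lam \<alpha> = (\<lambda>(a, x, y, \<mu>). \<alpha> * lam * (\<mu> \<bullet> y)\<^sup>2 + lam * (\<mu> \<bullet> x)\<^sup>2
      + ((lam * a) *\<^sub>R \<mu> - (x \<times> y)) \<bullet> ((lam * a) *\<^sub>R \<mu> - (x \<times> y)))"

definition h1 :: "real \<Rightarrow> real \<Rightarrow> L5 \<Rightarrow> real" where
  "h1 \<epsilon> \<alpha> = (\<lambda>(a, x, y, \<mu>). x \<bullet> x + \<alpha> * (y \<bullet> y) + \<alpha> * \<epsilon> * (\<mu> \<bullet> \<mu>) + \<epsilon> * a\<^sup>2)"

definition h2 :: "real \<Rightarrow> real \<Rightarrow> L5 \<Rightarrow> real" where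
  "h2 \<epsilon> \<alpha> = (\<lambda>(a, x, y, \<mu>). \<alpha> * \<epsilon> * (\<mu> \<bullet> y)\<^sup>2 + \<epsilon> * (\<mu> \<bullet> x)\<^sup>2
      + ((\<epsilon> * a) *\<^sub>R \<mu> - (x \<times> y)) \<bullet> ((\<epsilon> * a) *\<^sub>R \<mu> - (x \<times> y)))"

definition hamiltonian :: "real \<Rightarrow> real \<Rightarrow> real \<Rightarrow> real \<Rightarrow> L5 \<Rightarrow> real" where
  "hamiltonian \<epsilon> \<alpha> \<gamma> \<nu> = (\<lambda>p. \<gamma> * h1 \<epsilon> \<alpha> p + \<nu> * h2 \<epsilon> \<alpha> p)"

definition function_family :: "real \<Rightarrow> real \<Rightarrow> real \<Rightarrow> (L5 \<Rightarrow> real) set" where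
  "function_family lam \<epsilon> \<alpha> =
    {h1 \<epsilon> \<alpha>, h2 \<epsilon> \<alpha>,
     (\<lambda>(a, x, y, \<mu>). \<mu> \<bullet> \<mu>), (\<lambda>(a, x, y, \<mu>). \<mu> $ 3), (\<lambda>(a, x, y, \<mu>). a),
     (\<lambda>p. h1 \<epsilon> \<alpha> p - c1 lam \<alpha> p), (\<lambda>p. h2 \<epsilon> \<alpha> p - c2 lam \<alpha> p)}"

unbundle no cross3_syntax

end

theory Submission
  imports Defs
begin

text \<open>
  The value of \<open>{f, g}\<close> at a point \<open>p\<close> is a skew bilinear form in the gradients of \<open>f\<close> and \<open>g\<close>
  at \<open>p\<close>.  The functions \<open>c\<^sub>1\<close>, \<open>c\<^sub>2\<close> are Casimir functions; \<open>h\<^sub>1 - c\<^sub>1\<close> is a combination of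
  \<open>a\<^sup>2\<close> and \<open>\<mu>\<^sup>2\<close>; the vector \<open>\<mu>\<close> generates simultaneous rotations of \<open>x\<close>, \<open>y\<close>, \<open>\<mu>\<close>, and \<open>a\<close>
  generates a rotation mixing \<open>x\<close> and \<open>y\<close>, both of which preserve \<open>h\<^sub>2\<close>.  Hence at every point
  the gradients of all the functions in question lie in the span of the gradients of \<open>c\<^sub>1\<close>,
  \<open>c\<^sub>2\<close>, \<open>h\<^sub>2\<close>, \<open>a\<close>, \<open>\<mu>\<^sup>2\<close> and \<open>\<mu>\<^sub>3\<close>, which is isotropic for the bilinear form.
\<close>

unbundle cross3_syntax

text \<open>The Poisson tensor at a point, with gradients as free vectors: brackets can then be
  computed by linear algebra on \<open>L5\<close>, without derivatives.\<close>

definition gradient_bracket :: "real \<Rightarrow> real \<Rightarrow> L5 \<Rightarrow> L5 \<Rightarrow> L5 \<Rightarrow> real" where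
  "gradient_bracket lam \<alpha> = (\<lambda>(a, x, y, \<mu>) (fa, fx, fy, f\<mu>) (ga, gx, gy, g\<mu>).
      lam * a * (fx \<bullet> gy - fy \<bullet> gx)
    + \<mu> \<bullet> ((\<alpha> * lam) *\<^sub>R (fx \<times> gx) + lam *\<^sub>R (fy \<times> gy) + (f\<mu> \<times> g\<mu>))
    + ga * (x \<bullet> fy) - fa * (x \<bullet> gy)
    - \<alpha> * ga * (y \<bullet> fx) + \<alpha> * fa * (y \<bullet> gx)
    + x \<bullet> ((fx \<times> g\<mu>) + (f\<mu> \<times> gx))
    + y \<bullet> ((fy \<times> g\<mu>) + (f\<mu> \<times> gy)))"

definition grad_h1 :: "real \<Rightarrow> real \<Rightarrow> L5 \<Rightarrow> L5" where
  "grad_h1 \<epsilon> \<alpha> = (\<lambda>(a, x, y, \<mu>). (2 * \<epsilon> * a, 2 *\<^sub>R x, (2 * \<alpha>) *\<^sub>R y, (2 * \<alpha> * \<epsilon>) *\<^sub>R \<mu>))"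

definition grad_h2 :: "real \<Rightarrow> real \<Rightarrow> L5 \<Rightarrow> L5" where
  "grad_h2 \<epsilon> \<alpha> = (\<lambda>(a, x, y, \<mu>). let w = (\<epsilon> * a) *\<^sub>R \<mu> - (x \<times> y) in
     (2 * \<epsilon> * (w \<bullet> \<mu>),
      (2 * \<epsilon> * (\<mu> \<bullet> x)) *\<^sub>R \<mu> - 2 *\<^sub>R (y \<times> w),
      (2 * \<alpha> * \<epsilon> * (\<mu> \<bullet> y)) *\<^sub>R \<mu> - 2 *\<^sub>R (w \<times> x),
      (2 * \<alpha> * \<epsilon> * (\<mu> \<bullet> y)) *\<^sub>R y + (2 * \<epsilon> * (\<mu> \<bullet> x)) *\<^sub>R x + (2 * \<epsilon> * a) *\<^sub>R w))"

definition grad_mu :: "real^3 \<Rightarrow> L5" where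
  "grad_mu m = (0, 0, 0, m)"

text \<open>The first two vectors are the gradients of the Casimirs, since \<open>c1\<close> and
  \<open>c2\<close> are \<open>h1\<close> and \<open>h2\<close> with parameter \<open>lam\<close>.
  The vector \<open>grad_mu\<close> at \<mu> is half the gradient of \<mu> \<bullet> \<mu>.\<close>

definition isotropic_gradients :: "real \<Rightarrow> real \<Rightarrow> real \<Rightarrow> L5 \<Rightarrow> L5 set" where
  "isotropic_gradients lam \<epsilon> \<alpha> p = {grad_h1 lam \<alpha> p, grad_h2 lam \<alpha> p, grad_h2 \<epsilon> \<alpha> p,
     (1, 0, 0, 0), grad_mu (snd (snd (snd p))), grad_mu (axis 3 1)}"

lemmas component_simps = cross3_def inner_vec_def sum_3 vector_3

lemma gradient_bracket_skew:
  "gradient_bracket lam \<alpha> p f g = - gradient_bracket lam \<alpha> p g f"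
  by (cases p; cases f; cases g) (simp add: gradient_bracket_def component_simps algebra_simps)

lemma bilinear_gradient_bracket: "bilinear (gradient_bracket lam \<alpha> p)"
proof -
  have right: "linear (gradient_bracket lam \<alpha> p f)" for f
    by (cases p; cases f)
      (auto intro!: linearI simp: gradient_bracket_def component_simps algebra_simps)
  moreover have "linear (\<lambda>f. gradient_bracket lam \<alpha> p f g)" for g
    using linear_compose_neg[OF right] by (subst gradient_bracket_skew) simp
  ultimately show ?thesis
    by (simp add: bilinear_def)
qed

lemma gradient_bracket_grad_h1: "gradient_bracket lam \<alpha> p (grad_h1 lam \<alpha> p) g = 0"
  by (cases p; cases g)
    (simp add: gradient_bracket_def grad_h1_def component_simps algebra_simps)

lemma gradient_bracket_grad_h2: "gradient_bracket lam \<alpha> p (grad_h2 lam \<alpha> p) g = 0"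
  by (cases p; cases g)
    (simp add: gradient_bracket_def grad_h2_def Let_def component_simps algebra_simps)

text \<open>The flow of a is x' = \<alpha> y, y' = -x with a and \<mu> fixed. It preserves x
  \<times> y and \<alpha> (\<mu> \<bullet> y)^2 + (\<mu> \<bullet> x)^2, hence \<open>h2\<close> for
  every \<epsilon>.\<close>

lemma gradient_bracket_a_grad_h2:
  "gradient_bracket lam \<alpha> p (1, 0, 0, 0) (grad_h2 \<epsilon> \<alpha> p) = 0"
  by (cases p) (simp add: gradient_bracket_def grad_h2_def Let_def component_simps algebra_simps)

text \<open>Pairing with \<open>grad_mu m\<close> differentiates along the rotation of x, y, \<mu>
  about m, and \<open>h2\<close> is built from a and rotation-invariant expressions.\<close>

lemma gradient_bracket_mu_grad_h2:
  "gradient_bracket lam \<alpha> p (grad_mu m) (grad_h2 \<epsilon> \<alpha> p) = 0"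
  by (cases p)
    (simp add: gradient_bracket_def grad_mu_def grad_h2_def Let_def component_simps algebra_simps)

lemma gradient_bracket_a_mu: "gradient_bracket lam \<alpha> p (1, 0, 0, 0) (grad_mu m) = 0"
  by (cases p) (simp add: gradient_bracket_def grad_mu_def)

lemma gradient_bracket_mu_mu:
  "gradient_bracket lam \<alpha> p (grad_mu (snd (snd (snd p)))) (grad_mu m) = 0"
  by (cases p) (simp add: gradient_bracket_def grad_mu_def dot_cross_self)

lemma gradient_bracket_self: "gradient_bracket lam \<alpha> p f f = 0"
  using gradient_bracket_skew[of lam \<alpha> p f f] by simp

lemma gradient_bracket_isotropic:
  assumes "f \<in> isotropic_gradients lam \<epsilon> \<alpha> p" "g \<in> isotropic_gradients lam \<epsilon> \<alpha> p"
  shows "gradient_bracket lam \<alpha> p f g = 0"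
proof -
  note zero = gradient_bracket_grad_h1 gradient_bracket_grad_h2 gradient_bracket_a_grad_h2
    gradient_bracket_mu_grad_h2 gradient_bracket_a_mu gradient_bracket_mu_mu gradient_bracket_self
  \<comment> \<open>Each fact in \<open>zero\<close> fixes one order of the arguments; skew symmetry
    supplies the other.\<close>
  note zero' = zero[THEN trans[OF gradient_bracket_skew, OF arg_cong[where f = uminus]], simplified]
  show ?thesis
    using assms unfolding isotropic_gradients_def by (auto simp: zero zero')
qed

lemma gradient_bracket_span:
  assumes "f \<in> span (isotropic_gradients lam \<epsilon> \<alpha> p)" "g \<in> span (isotropic_gradients lam \<epsilon> \<alpha> p)"
  shows "gradient_bracket lam \<alpha> p f g = 0"
proof -
  \<comment> \<open>The zero form serves as comparison: bilinear maps that agree on the generators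
    agree on their spans.\<close>
  have "bilinear (\<lambda>f g :: L5. 0 :: real)"
    by (simp add: bilinear_def linear_zero)
  from bilinear_eq[OF bilinear_gradient_bracket this subset_refl subset_refl assms]
  show ?thesis
    using gradient_bracket_isotropic by blast
qed

text \<open>By uniqueness of the derivative, its value at \<open>axis i 1\<close> is the inner
  product with \<open>D\<close>, that is, the component \<open>D $ i\<close>.\<close>

lemma gradient_eq:
  assumes "GDERIV g v :> D"
  shows "gradient g v = D"
proof -
  have "frechet_derivative g (at v) = (\<lambda>h. h \<bullet> D)"
    using assms frechet_derivative_at unfolding gderiv_def by metis
  then show ?thesis
    by (simp add: gradient_def vec_eq_iff inner_axis')
qed

text \<open>Chain rule along the affine embedding of each coordinate slice. This links total
  gradients, which are easy to compute, to the partial derivatives in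
  \<open>bracket\<close>.\<close>

lemma GDERIV_slices:
  assumes "GDERIV f (a, x, y, \<mu>) :> (fa, fx, fy, f\<mu>)"
  shows "DERIV (\<lambda>a'. f (a', x, y, \<mu>)) a :> fa"
    and "GDERIV (\<lambda>x'. f (a, x', y, \<mu>)) x :> fx"
    and "GDERIV (\<lambda>y'. f (a, x, y', \<mu>)) y :> fy"
    and "GDERIV (\<lambda>\<mu>'. f (a, x, y, \<mu>')) \<mu> :> f\<mu>"
proof -
  have f: "(f has_derivative (\<lambda>h. h \<bullet> (fa, fx, fy, f\<mu>))) (at (a, x, y, \<mu>))"
    using assms by (simp add: gderiv_def)
  have "((\<lambda>a'. (a', x, y, \<mu>)) has_derivative (\<lambda>h. (h, 0, 0, 0))) (at a)"
    by (auto intro!: derivative_eq_intros simp: zero_prod_def)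
  from has_derivative_compose[OF this f]
  show "DERIV (\<lambda>a'. f (a', x, y, \<mu>)) a :> fa"
    by (simp add: has_field_derivative_def mult_commute_abs)
  have "((\<lambda>x'. (a, x', y, \<mu>)) has_derivative (\<lambda>h. (0, h, 0, 0))) (at x)"
    by (auto intro!: derivative_eq_intros simp: zero_prod_def)
  from has_derivative_compose[OF this f]
  show "GDERIV (\<lambda>x'. f (a, x', y, \<mu>)) x :> fx"
    by (simp add: gderiv_def)
  have "((\<lambda>y'. (a, x, y', \<mu>)) has_derivative (\<lambda>h. (0, 0, h, 0))) (at y)"
    by (auto intro!: derivative_eq_intros simp: zero_prod_def)
  from has_derivative_compose[OF this f]
  show "GDERIV (\<lambda>y'. f (a, x, y', \<mu>)) y :> fy"
    by (simp add: gderiv_def)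
  have "((\<lambda>\<mu>'. (a, x, y, \<mu>')) has_derivative (\<lambda>h. (0, 0, 0, h))) (at \<mu>)"
    by (auto intro!: derivative_eq_intros simp: zero_prod_def)
  from has_derivative_compose[OF this f]
  show "GDERIV (\<lambda>\<mu>'. f (a, x, y, \<mu>')) \<mu> :> f\<mu>"
    by (simp add: gderiv_def)
qed

lemma partials_GDERIV:
  assumes "GDERIV f p :> D"
  shows "(d_a f p, d_x f p, d_y f p, d_mu f p) = D"
  using GDERIV_slices assms
  by (cases p; cases D)
    (auto simp: d_a_def d_x_def d_y_def d_mu_def intro!: DERIV_imp_deriv gradient_eq)

lemma bracket_GDERIV:
  assumes "GDERIV f p :> D" "GDERIV g p :> E"
  shows "bracket lam \<alpha> f g p = gradient_bracket lam \<alpha> p D E"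
  unfolding partials_GDERIV[OF assms(1), symmetric] partials_GDERIV[OF assms(2), symmetric]
  by (cases p) (simp add: bracket_def gradient_bracket_def)

lemma GDERIV_h1: "GDERIV (h1 \<epsilon> \<alpha>) p :> grad_h1 \<epsilon> \<alpha> p"
  unfolding gderiv_def h1_def grad_h1_def case_prod_beta
  by (auto intro!: derivative_eq_intros
      simp: fun_eq_iff inner_prod_def inner_commute algebra_simps power2_eq_square)

lemmas has_derivative_cross =
  bounded_bilinear.FDERIV[OF bilinear_conv_bounded_bilinear[THEN iffD1, OF bilinear_cross]]

text \<open>The vector \<open>W\<close> whose square occurs in \<open>h2\<close> is differentiated
  separately; the resulting derivative is then rewritten as an inner product with
  \<open>grad_h2\<close>.\<close>

lemma GDERIV_h2: "GDERIV (h2 \<epsilon> \<alpha>) p :> grad_h2 \<epsilon> \<alpha> p"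
proof -
  obtain a x y \<mu> where p: "p = (a, x, y, \<mu>)"
    by (metis prod_cases4)
  define W where "W = (\<lambda>(a, x, y, \<mu>). (\<epsilon> * a) *\<^sub>R \<mu> - (x \<times> y))"
  define W' :: "L5 \<Rightarrow> real^3" where "W' = (\<lambda>(a', x', y', \<mu>').
    (\<epsilon> * a) *\<^sub>R \<mu>' + (\<epsilon> * a') *\<^sub>R \<mu> - (x \<times> y' + x' \<times> y))"
  define w where "w = W p"
  have W: "(W has_derivative W') (at p)"
    unfolding W_def W'_def case_prod_beta p
    by (auto intro!: derivative_eq_intros has_derivative_cross simp: fun_eq_iff)
  have h2: "h2 \<epsilon> \<alpha> = (\<lambda>p. \<alpha> * \<epsilon> * (snd (snd (snd p)) \<bullet> fst (snd (snd p)))\<^sup>2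
      + \<epsilon> * (snd (snd (snd p)) \<bullet> fst (snd p))\<^sup>2 + W p \<bullet> W p)"
    by (simp add: h2_def W_def fun_eq_iff)
  have deriv: "(h2 \<epsilon> \<alpha> has_derivative (\<lambda>(a', x', y', \<mu>').
      2 * \<alpha> * \<epsilon> * (\<mu> \<bullet> y) * (\<mu> \<bullet> y' + \<mu>' \<bullet> y) + 2 * \<epsilon> * (\<mu> \<bullet> x) * (\<mu> \<bullet> x' + \<mu>' \<bullet> x)
      + 2 * (w \<bullet> W' (a', x', y', \<mu>')))) (at p)"
    unfolding h2 case_prod_beta w_def
    by (rule derivative_eq_intros W refl)+ (simp add: p fun_eq_iff inner_commute algebra_simps)
  \<comment> \<open>Cyclic invariance of the triple product isolates x' and y', which yields the
    cross products in \<open>grad_h2\<close>.\<close>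
  have W': "w \<bullet> W' (a', x', y', \<mu>') = \<epsilon> * a' * (w \<bullet> \<mu>) - x' \<bullet> (y \<times> w)
      - y' \<bullet> (w \<times> x) + \<epsilon> * a * (\<mu>' \<bullet> w)" for a' x' y' \<mu>'
    by (simp add: W'_def component_simps algebra_simps)
  have grad: "grad_h2 \<epsilon> \<alpha> p = (2 * \<epsilon> * (w \<bullet> \<mu>),
      (2 * \<epsilon> * (\<mu> \<bullet> x)) *\<^sub>R \<mu> - 2 *\<^sub>R (y \<times> w),
      (2 * \<alpha> * \<epsilon> * (\<mu> \<bullet> y)) *\<^sub>R \<mu> - 2 *\<^sub>R (w \<times> x),
      (2 * \<alpha> * \<epsilon> * (\<mu> \<bullet> y)) *\<^sub>R y + (2 * \<epsilon> * (\<mu> \<bullet> x)) *\<^sub>R x + (2 * \<epsilon> * a) *\<^sub>R w)"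
    by (simp add: grad_h2_def w_def W_def p Let_def)
  show ?thesis
    unfolding gderiv_def
    by (rule has_derivative_eq_rhs[OF deriv])
      (simp add: fun_eq_iff W' grad inner_prod_def inner_diff_right inner_add_right
        inner_commute algebra_simps)
qed

lemma c1_eq_h1: "c1 = h1"
  by (simp add: fun_eq_iff c1_def h1_def)

lemma c2_eq_h2: "c2 = h2"
  by (simp add: fun_eq_iff c2_def h2_def)

text \<open>The difference of \<open>h1\<close> at \<epsilon> and at \<open>lam\<close> is
  (\<epsilon> - lam) (a^2 + \<alpha> \<mu> \<bullet> \<mu>), so its gradient is a combination of
  those of a and \<mu> \<bullet> \<mu>.\<close>

lemma grad_h1_in_span: "grad_h1 \<epsilon> \<alpha> p \<in> span (isotropic_gradients lam \<epsilon> \<alpha> p)"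
proof -
  have "grad_h1 \<epsilon> \<alpha> p = grad_h1 lam \<alpha> p + (2 * (\<epsilon> - lam) * fst p) *\<^sub>R (1, 0, 0, 0)
      + (2 * \<alpha> * (\<epsilon> - lam)) *\<^sub>R grad_mu (snd (snd (snd p)))"
    by (cases p) (simp add: grad_h1_def grad_mu_def algebra_simps)
  then show ?thesis
    by (simp only:) (intro span_add span_scale span_base; simp add: isotropic_gradients_def)
qed

lemma function_family_gradients:
  assumes "f \<in> function_family lam \<epsilon> \<alpha>"
  shows "\<exists>D \<in> span (isotropic_gradients lam \<epsilon> \<alpha> p). GDERIV f p :> D"
proof -
  let ?S = "span (isotropic_gradients lam \<epsilon> \<alpha> p)"
  have base: "grad_h1 lam \<alpha> p \<in> ?S" "grad_h2 lam \<alpha> p \<in> ?S" "grad_h2 \<epsilon> \<alpha> p \<in> ?S"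
    "(1, 0, 0, 0) \<in> ?S" "grad_mu (snd (snd (snd p))) \<in> ?S" "grad_mu (axis 3 1) \<in> ?S"
    by (auto intro: span_base simp: isotropic_gradients_def)
  have "GDERIV (\<lambda>(a, x, y, \<mu>). \<mu> \<bullet> \<mu>) p :> 2 *\<^sub>R grad_mu (snd (snd (snd p)))"
    unfolding gderiv_def grad_mu_def case_prod_beta
    by (auto intro!: derivative_eq_intros simp: fun_eq_iff inner_prod_def inner_commute)
  moreover have "GDERIV (\<lambda>(a, x, y, \<mu>). \<mu> $ 3) p :> grad_mu (axis 3 1)"
    unfolding gderiv_def grad_mu_def case_prod_beta
    by (auto intro!: derivative_eq_intros bounded_linear.has_derivative[OF bounded_linear_vec_nth]
        simp: fun_eq_iff inner_prod_def inner_axis)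
  moreover have "GDERIV (\<lambda>(a, x, y, \<mu>). a) p :> (1, 0, 0, 0)"
    unfolding gderiv_def case_prod_beta
    by (auto intro!: derivative_eq_intros simp: fun_eq_iff inner_prod_def)
  \<comment> \<open>Both gradients on the right lie in the span, the second as a Casimir gradient;
    the same holds for the difference with \<open>c2\<close>.\<close>
  moreover have "GDERIV (\<lambda>p. h1 \<epsilon> \<alpha> p - c1 lam \<alpha> p) p :> grad_h1 \<epsilon> \<alpha> p - grad_h1 lam \<alpha> p"
    unfolding c1_eq_h1 by (intro GDERIV_diff GDERIV_h1)
  moreover have "GDERIV (\<lambda>p. h2 \<epsilon> \<alpha> p - c2 lam \<alpha> p) p :> grad_h2 \<epsilon> \<alpha> p - grad_h2 lam \<alpha> p"
    unfolding c2_eq_h2 by (intro GDERIV_diff GDERIV_h2)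
  ultimately show ?thesis
    using assms base grad_h1_in_span GDERIV_h1 GDERIV_h2 span_scale span_diff
    unfolding function_family_def by (elim insertE emptyE) blast+
qed

lemma hamiltonian_gradient:
  "\<exists>D \<in> span (isotropic_gradients lam \<epsilon> \<alpha> p). GDERIV (hamiltonian \<epsilon> \<alpha> \<gamma> \<nu>) p :> D"
proof
  show "GDERIV (hamiltonian \<epsilon> \<alpha> \<gamma> \<nu>) p :> \<gamma> *\<^sub>R grad_h1 \<epsilon> \<alpha> p + \<nu> *\<^sub>R grad_h2 \<epsilon> \<alpha> p"
    unfolding hamiltonian_def
    using GDERIV_add[OF GDERIV_mult[OF GDERIV_const GDERIV_h1] GDERIV_mult[OF GDERIV_const GDERIV_h2]]
    by simp
  show "\<gamma> *\<^sub>R grad_h1 \<epsilon> \<alpha> p + \<nu> *\<^sub>R grad_h2 \<epsilon> \<alpha> p \<in> span (isotropic_gradients lam \<epsilon> \<alpha> p)"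
    by (intro span_add span_scale grad_h1_in_span) (simp add: span_base isotropic_gradients_def)
qed

unbundle no cross3_syntax

theorem mainTheorem1:
  fixes \<alpha> lam \<epsilon> \<gamma> \<nu> :: real
  assumes "\<alpha> \<noteq> 0" and "lam \<noteq> \<epsilon>"
  shows "(\<forall>f \<in> function_family lam \<epsilon> \<alpha>. integral_of_motion lam \<alpha> (hamiltonian \<epsilon> \<alpha> \<gamma> \<nu>) f)
       \<and> (\<forall>f \<in> function_family lam \<epsilon> \<alpha>. \<forall>g \<in> function_family lam \<epsilon> \<alpha>. in_involution lam \<alpha> f g)"
  unfolding integral_of_motion_def in_involution_def
  using function_family_gradients hamiltonian_gradient bracket_GDERIV gradient_bracket_span
  by metis

end
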